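(* Let $p$ be a prime and let $R$ be a finite $p$-ring. If $R$ is left $p$-nil or right $p$-nil, then $rk(R^\circ) = d(R^{+})$. In particular, $rk(R^\circ) = d(\Omega_{1}(R^\circ))$.
   Context: Rings are associative, not necessarily commutative or with identity. A $p$-ring is a ring $R$ whose additive group $R^+$ is a $p$-group. The circle operation on $R$ is $x\circ y=x+y+xy$; $R$ is a monoid under $\circ$ with identity $0$, and the adjoint group $R^\circ$ is the group of invertible elements of this monoid. $R$ is left $p$-nil if, for every $x\in R$, $px=0$ (for $p>2$), respectively $4x=0$ (for $p=2$), implies $xy=0$ for all $y\in R$. $R$ is right $p$-nil if its opposite ring is left $p$-nil. For a group $G$, $d(G)$ is the minimal number of generators of $G$, $rk(G)=\sup\{d(H): H \text{ a finitely generated subgroup of } G\}$ is its (Prüfer) rank, and $\Omega_1(G)$ is the subgroup generated by all $x\in G$ with $x^p=1$. *)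

theory Defs
  imports
    "HOL-Algebra.Algebra"
    "HOL-Library.Extended_Nat"
    "HOL-Computational_Algebra.Primes"
begin

(* Associative rings, not necessarily commutative or with identity. The locale
   ring of HOL-Algebra demands an identity; here the field one of the record is
   left completely unconstrained and is never used. *)
locale nonunital_ring = abelian_group R for R (structure) +
  assumes m_closed: "\<lbrakk>x \<in> carrier R; y \<in> carrier R\<rbrakk> \<Longrightarrow> x \<otimes> y \<in> carrier R"
    and m_assoc: "\<lbrakk>x \<in> carrier R; y \<in> carrier R; z \<in> carrier R\<rbrakk>
          \<Longrightarrow> (x \<otimes> y) \<otimes> z = x \<otimes> (y \<otimes> z)"
    and l_distr: "\<lbrakk>x \<in> carrier R; y \<in> carrier R; z \<in> carrier R\<rbrakk>
          \<Longrightarrow> (x \<oplus> y) \<otimes> z = x \<otimes> z \<oplus> y \<otimes> z"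
    and r_distr: "\<lbrakk>x \<in> carrier R; y \<in> carrier R; z \<in> carrier R\<rbrakk>
          \<Longrightarrow> z \<otimes> (x \<oplus> y) = z \<otimes> x \<oplus> z \<otimes> y"

definition opposite_ring :: "('a, 'm) ring_scheme \<Rightarrow> ('a, 'm) ring_scheme" where
  "opposite_ring R = R\<lparr>monoid.mult := (\<lambda>x y. y \<otimes>\<^bsub>R\<^esub> x)\<rparr>"

definition adjoint_monoid :: "('a, 'm) ring_scheme \<Rightarrow> 'a monoid" where
  "adjoint_monoid R =
     \<lparr>carrier = carrier R, monoid.mult = (\<lambda>x y. x \<oplus>\<^bsub>R\<^esub> y \<oplus>\<^bsub>R\<^esub> x \<otimes>\<^bsub>R\<^esub> y), one = \<zero>\<^bsub>R\<^esub>\<rparr>"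

definition adjoint_group :: "('a, 'm) ring_scheme \<Rightarrow> 'a monoid" where
  "adjoint_group R = units_of (adjoint_monoid R)"

definition is_p_group :: "nat \<Rightarrow> ('a, 'm) monoid_scheme \<Rightarrow> bool" where
  "is_p_group p G \<longleftrightarrow> group G \<and> (\<forall>x\<in>carrier G. \<exists>n::nat. group.ord G x = p ^ n)"

definition p_ring :: "nat \<Rightarrow> ('a, 'm) ring_scheme \<Rightarrow> bool" where
  "p_ring p R \<longleftrightarrow> nonunital_ring R \<and> is_p_group p (add_monoid R)"

definition left_p_nil :: "nat \<Rightarrow> ('a, 'm) ring_scheme \<Rightarrow> bool" where
  "left_p_nil p R \<longleftrightarrow>
     (\<forall>x\<in>carrier R. [(if p = 2 then 4 else p)] \<cdot>\<^bsub>R\<^esub> x = \<zero>\<^bsub>R\<^esub>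
        \<longrightarrow> (\<forall>y\<in>carrier R. x \<otimes>\<^bsub>R\<^esub> y = \<zero>\<^bsub>R\<^esub>))"

definition right_p_nil :: "nat \<Rightarrow> ('a, 'm) ring_scheme \<Rightarrow> bool" where
  "right_p_nil p R \<longleftrightarrow> left_p_nil p (opposite_ring R)"

(* The infimum over the empty set is \<infinity>, so a group that is not finitely
   generated gets the value \<infinity>. *)
definition min_gens :: "('a, 'm) monoid_scheme \<Rightarrow> enat" where
  "min_gens G = (INF A \<in> {A. finite A \<and> A \<subseteq> carrier G \<and> generate G A = carrier G}. enat (card A))"

definition fin_gen :: "('a, 'm) monoid_scheme \<Rightarrow> bool" where
  "fin_gen G \<longleftrightarrow> (\<exists>A. finite A \<and> A \<subseteq> carrier G \<and> generate G A = carrier G)"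

definition pruefer_rank :: "('a, 'm) monoid_scheme \<Rightarrow> enat" where
  "pruefer_rank G =
     (SUP H \<in> {H. subgroup H G \<and> fin_gen (G\<lparr>carrier := H\<rparr>)}. min_gens (G\<lparr>carrier := H\<rparr>))"

definition Omega1 :: "nat \<Rightarrow> ('a, 'm) monoid_scheme \<Rightarrow> ('a, 'm) monoid_scheme" where
  "Omega1 p G = G\<lparr>carrier := generate G {x \<in> carrier G. x [^]\<^bsub>G\<^esub> p = \<one>\<^bsub>G\<^esub>}\<rparr>"

end

theory Submission
  imports Defs
begin

text \<open>
  Write \<open>T\<^sub>k\<close> for the additive \<open>p\<^sup>k\<close>-torsion of \<open>R\<close>, let \<open>p\<^sup>d\<close> be the order of \<open>T\<^sub>1\<close>, and let
  \<open>\<star>\<close> be the circle operation. All three numbers in the theorem equal \<open>d\<close>.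

  Nilness is used through its effect on torsion. If \<open>x\<close> and \<open>y\<close> lie in \<open>T\<^sub>k\<^sub>+\<^sub>1\<close>, then
  \<open>p\<^sup>k x\<close> and \<open>p\<^sup>k y\<close> are killed by \<open>p\<close>, so \<open>p\<^sup>k x y = 0\<close>, whichever side the hypothesis is
  about. Hence multiplication by \<open>p\<^sup>k\<close> is a homomorphism from \<open>T\<^sub>k\<^sub>+\<^sub>1\<close> under \<open>\<star>\<close> to the
  additive group \<open>T\<^sub>1\<close>, with kernel \<open>T\<^sub>k\<close> (\<open>scaling_hom\<close>). Moreover the terms of degree at least
  two in the binomial expansion of the \<open>p\<close>-th circle power \<open>x\<^sup>[\<^sup>p\<^sup>]\<close> vanish after multiplication
  by \<open>p\<^sup>k\<close> when \<open>x\<close> lies in \<open>T\<^sub>k\<^sub>+\<^sub>2\<close>, so \<open>p\<^sup>k x\<^sup>[\<^sup>p\<^sup>] = p\<^sup>k\<^sup>+\<^sup>1 x\<close> (\<open>circle_pow_p\<close>). Thus taking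
  \<open>p\<close>-th circle powers sends \<open>T\<^sub>k\<^sub>+\<^sub>1\<close> into \<open>T\<^sub>k\<close>. This makes every element of \<open>R\<close> invertible under
  \<open>\<star>\<close>, since some iterated \<open>p\<close>-th power of it is \<open>0\<close>, and identifies \<open>T\<^sub>1\<close> with the set of
  solutions of \<open>x\<^sup>[\<^sup>p\<^sup>] = 0\<close>. On \<open>T\<^sub>1\<close> the operation \<open>\<star>\<close> is addition, so \<open>T\<^sub>1\<close> is
  \<open>\<Omega>\<^sub>1\<close> of the adjoint group, elementary abelian of rank \<open>d\<close>.

  The heart is the upper bound: each subgroup \<open>H\<close> of the adjoint group has at most \<open>d\<close> generators
  (\<open>subgroup_generators\<close>). The elementary abelian groups \<open>V\<^sub>k = p\<^sup>k (H \<inter> T\<^sub>k\<^sub>+\<^sub>1)\<close> decrease as \<open>k\<close>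
  grows and are the successive quotients of the torsion filtration of \<open>H\<close>. Naively one would need
  the sum of their ranks. However, for \<open>x\<close> in \<open>H \<inter> T\<^sub>k\<^sub>+\<^sub>2\<close> the element \<open>p\<^sup>k\<^sup>+\<^sup>1 x\<close> of \<open>V\<^sub>k\<close> is the
  image of the \<open>p\<close>-th power of \<open>x\<close>; so generators chosen for \<open>V\<^sub>k\<^sub>+\<^sub>1\<close> already produce, through
  their \<open>p\<close>-th powers, the subgroup \<open>V\<^sub>k\<^sub>+\<^sub>1\<close> of \<open>V\<^sub>k\<close>, and only a complement of it needs new
  generators (\<open>partial_generators_step\<close>). The ranks telescope and at most \<open>rank V\<^sub>0 \<le> d\<close> generators
  suffice.

  The additive group has \<open>|R : p R| = |T\<^sub>1| = p\<^sup>d\<close>, so the Burnside basis theorem for the abelian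
  \<open>p\<close>-group \<open>R\<^sup>+\<close> gives exactly \<open>d\<close> generators. Throughout, ranks are compared
  through orders: a number \<open>n\<close> of generators enters only as \<open>p\<^sup>n\<close>.
\<close>

(* Frees the symbol for additive multiples, which it shares with products of ideals. *)
no_notation ideal_prod (infixl "\<cdot>\<index>" 80)

section \<open>Generating abelian groups over a subgroup\<close>

lemma (in group) subgroup_nat_pow_closed:
  assumes "subgroup H G" "x \<in> H"
  shows "x [^] (n::nat) \<in> H"
  using subgroup_int_pow_closed[OF assms, of "int n"] by (simp add: int_pow_int)

text \<open>
  Adjoining one \<open>a\<close> with \<open>a\<^sup>p\<close> in the subgroup \<open>J\<close> adds at most the \<open>p\<close> cosets \<open>J a\<^sup>n\<close> with
  \<open>n < p\<close>. This is the source of all lower bounds for numbers of generators.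
\<close>

lemma (in comm_group) card_generate_le:
  assumes "finite A" "A \<subseteq> carrier G" "subgroup I G" "finite I"
    and "\<And>a. a \<in> A \<Longrightarrow> a [^] p \<in> I" and "(p::nat) > 0"
  shows "finite (generate G (I \<union> A)) \<and> card (generate G (I \<union> A)) \<le> card I * p ^ card A"
  using assms(1,2,5)
proof (induction A)
  case empty
  have "generate G I = I"
    using generateI[OF assms(3), of I] by auto
  then show ?case using assms by simp
next
  case (insert a A)
  define J where "J = generate G (I \<union> A)"
  define f where "f = (\<lambda>(j, n). j \<otimes> a [^] (n::nat))"
  have Ic: "I \<subseteq> carrier G" using assms(3) subgroup.subset by blast
  have IH: "finite J" "card J \<le> card I * p ^ card A"
    using insert by (auto simp: J_def)
  have J: "subgroup J G" unfolding J_def using generate_is_subgroup Ic insert.prems by auto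
  have sub: "I \<union> A \<subseteq> J" by (auto simp: J_def intro: generate.incl)
  have ac: "a \<in> carrier G" and ap: "a [^] p \<in> J" using insert.prems sub by auto
  have Jc: "j \<in> carrier G" if "j \<in> J" for j using J subgroup.mem_carrier that by metis
  have red: "j \<otimes> a [^] n \<in> f ` (J \<times> {..<p})" if "j \<in> J" for j and n :: nat
  proof -
    have apn: "(a [^] p) [^] (n div p) \<in> J"
      using subgroup_nat_pow_closed[OF J ap] .
    have "a [^] n = (a [^] p) [^] (n div p) \<otimes> a [^] (n mod p)"
      using ac by (simp add: nat_pow_pow nat_pow_mult)
    then have "j \<otimes> a [^] n = f (j \<otimes> (a [^] p) [^] (n div p), n mod p)"
      using ac Jc that by (simp add: f_def m_assoc)
    then show ?thesis using apn that J assms(6) by (auto simp: subgroup.m_closed)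
  qed
  have "x \<in> f ` (J \<times> {..<p})" if "x \<in> generate G (I \<union> insert a A)" for x
    using that
  proof (induction rule: generate.induct)
    case one
    then show ?case using red[of \<one> 0] J by (simp add: subgroup.one_closed)
  next
    case (incl h)
    then show ?case using red[of h 0] red[of \<one> 1] J sub Jc ac by (auto simp: subgroup.one_closed)
  next
    case (inv h)
    show ?case
    proof (cases "h = a")
      case True
      have "inv a = inv (a [^] p) \<otimes> a [^] (p - 1)"
      proof -
        have "inv (a [^] p) \<otimes> a [^] (p - 1) \<otimes> a = inv (a [^] p) \<otimes> a [^] p"
          using ac nat_pow_Suc[of a "p - 1"] assms(6) by (simp add: m_assoc)
        then show ?thesis using ac by (metis inv_closed inv_equality l_inv m_closed nat_pow_closed)
      qed
      then show ?thesis using True red[of "inv (a [^] p)" "p - 1"] ap J by (simp add: subgroup.m_inv_closed)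
    next
      case False
      then have "h \<in> J" using inv sub by auto
      then show ?thesis using red[of "inv h" 0] J Jc by (simp add: subgroup.m_inv_closed)
    qed
  next
    case (eng h1 h2)
    then obtain j m k n where "j \<in> J" "h1 = j \<otimes> a [^] (m::nat)" "k \<in> J" "h2 = k \<otimes> a [^] (n::nat)"
      by (auto simp: f_def)
    moreover from this have "h1 \<otimes> h2 = (j \<otimes> k) \<otimes> a [^] (m + n)"
      using ac Jc by (simp add: m_ac nat_pow_mult[symmetric])
    ultimately show ?case using red[of "j \<otimes> k"] J by (simp add: subgroup.m_closed)
  qed
  then have *: "generate G (I \<union> insert a A) \<subseteq> f ` (J \<times> {..<p})" by auto
  have fin: "finite (f ` (J \<times> {..<p}))" using IH by simp
  have "card (generate G (I \<union> insert a A)) \<le> card (f ` (J \<times> {..<p}))"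
    using * fin card_mono by blast
  also have "\<dots> \<le> card J * p"
    using card_image_le[of "J \<times> {..<p}" f] IH by (simp add: card_cartesian_product)
  also have "\<dots> \<le> card I * p ^ card (insert a A)"
    using IH insert.hyps by (simp add: mult.assoc mult.commute[of p])
  finally show ?case using * fin finite_subset by blast
qed

text \<open>
  The cosets of \<open>1, x, \<dots>, x\<^sup>p\<^sup>-\<^sup>1\<close> are distinct: otherwise some \<open>x\<^sup>n\<close> with \<open>n\<close> prime to \<open>p\<close>
  lies in \<open>I\<close>, and as \<open>x\<^sup>p\<close> does too, so does \<open>x\<close>.
\<close>

lemma (in comm_group) index_ge_prime:
  assumes "subgroup I G" "finite I" "x \<in> carrier G" "x \<notin> I" "x [^] p \<in> I"
    and "Factorial_Ring.prime (p::nat)" "subgroup J G" "finite J" "I \<subseteq> J" "x \<in> J"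
  shows "card I * p \<le> card J"
proof -
  define f where "f = (\<lambda>(j, n). j \<otimes> x [^] (n::nat))"
  have Ic: "i \<in> carrier G" if "i \<in> I" for i using assms(1) that subgroup.mem_carrier by metis
  have key: False if "i \<in> I" "j \<in> I" "i \<otimes> x [^] m = j \<otimes> x [^] n" "m < n" "n < p" for i j and m n :: nat
  proof -
    have "j \<otimes> x [^] (n - m) \<otimes> x [^] m = i \<otimes> x [^] m"
      using that Ic assms(3) by (simp add: m_assoc nat_pow_mult)
    then have "j \<otimes> x [^] (n - m) = i"
      using Ic that(1,2) assms(3) by (metis m_closed nat_pow_closed r_cancel)
    then have "x [^] (n - m) = inv j \<otimes> i" using Ic that assms(3) inv_solve_left by (metis nat_pow_closed)
    then have dI: "x [^] (n - m) \<in> I" using that assms(1) by (simp add: subgroup.m_closed subgroup.m_inv_closed)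
    have "coprime (n - m) p"
      using that assms(6) by (metis coprime_commute diff_is_0_eq dvd_imp_le leD less_imp_diff_less
          not_gr_zero prime_imp_coprime)
    \<comment> \<open>A Bezout relation expresses \<open>x\<close> through \<open>x\<^sup>n\<^sup>-\<^sup>m\<close> and \<open>x\<^sup>p\<close>.\<close>
    then obtain u v where "(n - m) * u = p * v + 1"
      using bezout_nat[of "n - m" p] \<open>m < n\<close> by (metis coprime_imp_gcd_eq_1 diff_is_0_eq leD)
    then have "x [^] ((n - m) * u) = x [^] (p * v) \<otimes> x" by simp
    then have "(x [^] (n - m)) [^] u = (x [^] p) [^] v \<otimes> x" using assms(3) by (simp add: nat_pow_pow)
    then have "x = inv ((x [^] p) [^] v) \<otimes> (x [^] (n - m)) [^] u"
      using assms(3) inv_solve_left by (metis nat_pow_closed)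
    moreover have "inv ((x [^] p) [^] v) \<otimes> (x [^] (n - m)) [^] u \<in> I"
      using subgroup_nat_pow_closed[OF assms(1) dI] subgroup_nat_pow_closed[OF assms(1,5)] assms(1)
      by (simp add: subgroup.m_closed subgroup.m_inv_closed)
    ultimately show False using assms(4) by simp
  qed
  have "inj_on f (I \<times> {..<p})"
  proof (rule inj_onI, clarsimp simp: f_def)
    fix i m j n assume *: "i \<in> I" "j \<in> I" "m < p" "n < p" "i \<otimes> x [^] m = j \<otimes> x [^] (n::nat)"
    then have "m = n" using key[of i j m n] key[of j i n m] by (metis nat_neq_iff)
    then show "i = j \<and> m = n" using * Ic assms(3) by simp
  qed
  moreover have "f ` (I \<times> {..<p}) \<subseteq> J"
    using assms subgroup_nat_pow_closed[OF assms(7,10)] by (auto simp: f_def intro!: subgroup.m_closed)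
  ultimately have "card (I \<times> {..<p}) \<le> card J"
    using card_inj_on_le assms(8) by blast
  then show ?thesis by (simp add: card_cartesian_product)
qed

text \<open>
  The quotient of \<open>E\<close> by \<open>I\<close> is a vector space over the field with \<open>p\<close> elements, and \<open>B\<close> lifts a
  basis of it. Expressing its dimension through orders lets the proof avoid the quotient: adjoin
  elements outside the subgroup reached so far, each of which multiplies the order by at least \<open>p\<close>.
\<close>

lemma (in comm_group) exists_generators_over:
  assumes "Factorial_Ring.prime (p::nat)" "subgroup E G" "finite E" "subgroup I G" "I \<subseteq> E"
    and "\<And>x. x \<in> E \<Longrightarrow> x [^] p \<in> I"
  shows "\<exists>B. B \<subseteq> E \<and> generate G (I \<union> B) = E \<and> card I * p ^ card B \<le> card E"
  using assms(4,5,6)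
proof (induction "card E - card I" arbitrary: I rule: less_induct)
  case less
  have finI: "finite I" using less.prems(2) assms(3) finite_subset by blast
  show ?case
  proof (cases "I = E")
    case True
    then have "generate G (I \<union> {}) = E" using generateI[OF assms(2), of E] by auto
    then show ?thesis using True by (intro exI[of _ "{}"]) simp
  next
    case False
    then obtain x where x: "x \<in> E" "x \<notin> I" using less.prems by auto
    define J where "J = generate G (I \<union> {x})"
    have Ec: "E \<subseteq> carrier G" using assms(2) subgroup.subset by blast
    have J: "subgroup J G" unfolding J_def using less.prems x Ec by (intro generate_is_subgroup) auto
    have JE: "J \<subseteq> E" unfolding J_def using generate_subgroup_incl[OF _ assms(2)] less.prems x by auto
    have IJ: "I \<subseteq> J" "x \<in> J" by (auto simp: J_def intro: generate.incl)
    have finJ: "finite J" using JE assms(3) finite_subset by blast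
    have card: "card I * p \<le> card J"
      using index_ge_prime[OF less.prems(1) finI _ x(2) less.prems(3)[OF x(1)] assms(1) J finJ IJ] x Ec by auto
    have "card I < card J" using IJ x finJ by (intro psubset_card_mono) auto
    moreover have "card J \<le> card E" using JE assms(3) card_mono by blast
    ultimately obtain B where B: "B \<subseteq> E" "generate G (J \<union> B) = E" "card J * p ^ card B \<le> card E"
      using less.hyps[of J] J JE less.prems(3) IJ by (metis diff_less_mono2 order_less_le_trans subsetD)
    have gE: "generate G (I \<union> insert x B) = E"
    proof
      show "generate G (I \<union> insert x B) \<subseteq> E"
        using generate_subgroup_incl[OF _ assms(2)] less.prems x B by auto
      have S: "subgroup (generate G (I \<union> insert x B)) G"
        using less.prems x B Ec by (intro generate_is_subgroup) auto
      have "J \<subseteq> generate G (I \<union> insert x B)" unfolding J_def by (intro mono_generate) auto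
      moreover have "B \<subseteq> generate G (I \<union> insert x B)" by (auto intro: generate.incl)
      ultimately show "E \<subseteq> generate G (I \<union> insert x B)"
        using generate_subgroup_incl[OF _ S, of "J \<union> B"] B(2) by auto
    qed
    have "card I * p ^ card (insert x B) \<le> card I * p ^ Suc (card B)"
      using assms(1) prime_ge_1_nat by (intro mult_left_mono power_increasing) (auto simp: card_insert_le_m1 card_insert_if)
    also have "\<dots> \<le> card J * p ^ card B" using card by (simp add: mult.assoc[symmetric])
    also have "\<dots> \<le> card E" using B by simp
    finally show ?thesis using gE B(1) x by (intro exI[of _ "insert x B"]) auto
  qed
qed

section \<open>The circle operation\<close>

text \<open>
  Composing the inverse of a power \<open>x\<^sup>n\<close> with \<open>x\<^sup>n\<^sup>-\<^sup>1\<close> on either side inverts \<open>x\<close>. In the adjoint monoid of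
  a \<open>p\<close>-nil ring every element has a power equal to the identity.
\<close>

lemma (in monoid) Units_of_pow:
  assumes "x \<in> carrier G" "x [^] (n::nat) \<in> Units G" "n > 0"
  shows "x \<in> Units G"
proof -
  define y where "y = x [^] (n - 1)"
  define u where "u = inv (x [^] n)"
  have c: "y \<in> carrier G" "u \<in> carrier G" using assms by (auto simp: y_def u_def)
  have xy: "x \<otimes> y = x [^] n" "y \<otimes> x = x [^] n"
    using assms(1,3) nat_pow_Suc2[of x "n - 1"] nat_pow_Suc[of x "n - 1"] by (auto simp: y_def)
  have r: "x \<otimes> (y \<otimes> u) = \<one>" using c assms xy by (simp add: m_assoc[symmetric] u_def)
  have l: "(u \<otimes> y) \<otimes> x = \<one>" using c assms xy by (simp add: m_assoc u_def)
  show ?thesis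
    using inv_unique[OF l r] l r c assms(1) unfolding Units_def by (metis (mono_tags, lifting) CollectI m_closed)
qed

context nonunital_ring
begin

lemma null [simp]:
  assumes "x \<in> carrier R"
  shows "\<zero> \<otimes> x = \<zero>" "x \<otimes> \<zero> = \<zero>"
  using l_distr[of \<zero> \<zero> x] r_distr[of \<zero> \<zero> x] assms m_closed[of x \<zero>] m_closed[of \<zero> x]
  by (metis add.l_cancel_one' l_zero zero_closed)+

lemma add_pow_mult:
  assumes "x \<in> carrier R" "y \<in> carrier R"
  shows "[(n::nat)] \<cdot> (x \<otimes> y) = ([n] \<cdot> x) \<otimes> y" "[n] \<cdot> (x \<otimes> y) = x \<otimes> ([n] \<cdot> y)"
  by (induction n) (use assms in \<open>auto simp: l_distr r_distr m_closed\<close>)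

abbreviation (input) circle :: "'a \<Rightarrow> 'a \<Rightarrow> 'a" (infixl "\<star>" 70)
  where "x \<star> y \<equiv> x \<otimes>\<^bsub>adjoint_group R\<^esub> y"

lemma circle_eq: "x \<star> y = x \<oplus> y \<oplus> x \<otimes> y"
  by (simp add: adjoint_group_def units_of_mult adjoint_monoid_def)

lemma one_adjoint_group: "\<one>\<^bsub>adjoint_group R\<^esub> = \<zero>"
  by (simp add: adjoint_group_def units_of_one adjoint_monoid_def)

lemma monoid_adjoint_monoid: "monoid (adjoint_monoid R)"
proof (rule monoidI)
  fix x y z assume "x \<in> carrier (adjoint_monoid R)" "y \<in> carrier (adjoint_monoid R)" 
    "z \<in> carrier (adjoint_monoid R)"
  then show "x \<otimes>\<^bsub>adjoint_monoid R\<^esub> y \<otimes>\<^bsub>adjoint_monoid R\<^esub> z =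
     x \<otimes>\<^bsub>adjoint_monoid R\<^esub> (y \<otimes>\<^bsub>adjoint_monoid R\<^esub> z)"
    by (simp add: adjoint_monoid_def m_closed l_distr r_distr m_assoc a_ac)
qed (auto simp: adjoint_monoid_def m_closed)

lemma group_adjoint_group: "group (adjoint_group R)"
  unfolding adjoint_group_def by (rule monoid.units_group[OF monoid_adjoint_monoid])

lemma circle_pow_in_carrier:
  assumes "x \<in> carrier R"
  shows "x [^]\<^bsub>adjoint_group R\<^esub> (n::nat) \<in> carrier R"
  by (induction n) (use assms in \<open>auto simp: circle_eq one_adjoint_group m_closed\<close>)

text \<open>
  The \<open>n\<close>-th circle power of \<open>x\<close> is \<open>(1 + x)\<^sup>n - 1\<close>, that is, the sum of the
  \<open>(n choose i) x\<^sup>i\<close> over positive \<open>i\<close>. Once the multiplier \<open>N\<close> kills the cube of \<open>x\<close>, only the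
  first two terms survive, which spares binomial sums in a ring without identity.
\<close>

lemma circle_pow_quadratic:
  fixes N n :: nat
  assumes x: "x \<in> carrier R" and cube: "[N] \<cdot> (x \<otimes> x \<otimes> x) = \<zero>"
  shows "[N] \<cdot> (x [^]\<^bsub>adjoint_group R\<^esub> n) = [(N * n)] \<cdot> x \<oplus> [(N * (n choose 2))] \<cdot> (x \<otimes> x)"
proof (induction n)
  case 0
  then show ?case using x by (simp add: one_adjoint_group m_closed numeral_2_eq_2)
next
  case (Suc n)
  let ?f = "x [^]\<^bsub>adjoint_group R\<^esub> n"
  have f: "?f \<in> carrier R" using circle_pow_in_carrier[OF x] .
  have xx: "x \<otimes> x \<in> carrier R" and xxx: "x \<otimes> x \<otimes> x \<in> carrier R" using x by (auto simp: m_closed)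
  have "[(N * (n choose 2))] \<cdot> (x \<otimes> x \<otimes> x) = \<zero>"
    using cube xxx add.nat_pow_pow[of "x \<otimes> x \<otimes> x" "n choose 2" N] by simp
  then have cz: "([(N * (n choose 2))] \<cdot> (x \<otimes> x)) \<otimes> x = \<zero>"
    using xx x by (simp add: add_pow_mult(1))
  have "[N] \<cdot> (x [^]\<^bsub>adjoint_group R\<^esub> Suc n) = [N] \<cdot> ?f \<oplus> [N] \<cdot> x \<oplus> ([N] \<cdot> ?f) \<otimes> x"
    using x f by (simp add: circle_eq add.nat_pow_distrib m_closed add_pow_mult(1))
  also have "\<dots> = [(N * n)] \<cdot> x \<oplus> [(N * (n choose 2))] \<cdot> (x \<otimes> x) \<oplus> [N] \<cdot> x \<oplus> [(N * n)] \<cdot> (x \<otimes> x)"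
    using x xx Suc.IH cz by (simp add: l_distr m_closed add_pow_mult(1))
  also have "\<dots> = ([(N * n)] \<cdot> x \<oplus> [N] \<cdot> x) \<oplus> ([(N * (n choose 2))] \<cdot> (x \<otimes> x) \<oplus> [(N * n)] \<cdot> (x \<otimes> x))"
    using x xx by (simp add: a_ac)
  also have "\<dots> = [(N * Suc n)] \<cdot> x \<oplus> [(N * (Suc n choose 2))] \<cdot> (x \<otimes> x)"
    using x xx by (simp add: add.nat_pow_mult numeral_2_eq_2 algebra_simps)
  finally show ?case .
qed

end

section \<open>Circle powers and torsion in p-nil rings\<close>

locale p_nil_ring = nonunital_ring R for R (structure) +
  fixes p :: nat
  assumes prime_p: "Factorial_Ring.prime p"
    and p_power_torsion: "x \<in> carrier R \<Longrightarrow> \<exists>n::nat. [(p ^ n)] \<cdot> x = \<zero>"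
    and fin: "finite (carrier R)"
    and nil: "left_p_nil p R \<or> right_p_nil p R"
begin

lemma p_pos: "p > 0"
  using prime_p prime_gt_0_nat by simp

text \<open>
  Both alternatives are carried along together, since every consequence below has a left-right
  symmetric statement; passing to the opposite ring would instead require comparing two adjoint
  groups.
\<close>

lemma left_or_right_annihilator:
  "(\<forall>z\<in>carrier R. [(if p = 2 then 4 else p)] \<cdot> z = \<zero> \<longrightarrow> (\<forall>y\<in>carrier R. z \<otimes> y = \<zero>)) \<or>
   (\<forall>z\<in>carrier R. [(if p = 2 then 4 else p)] \<cdot> z = \<zero> \<longrightarrow> (\<forall>y\<in>carrier R. y \<otimes> z = \<zero>))"
proof -
  have "add_pow (opposite_ring R) n z = [n] \<cdot> z" for n :: nat and z
    by (simp add: opposite_ring_def add_pow_def nat_pow_def)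
  then show ?thesis
    using nil unfolding right_p_nil_def left_p_nil_def by (auto simp: opposite_ring_def)
qed

lemma annihilates_commuting:
  assumes "z \<in> carrier R" "x \<in> carrier R" "z \<otimes> x = x \<otimes> z"
    and "[(if p = 2 then 4 else p)] \<cdot> z = \<zero>"
  shows "z \<otimes> x = \<zero>"
  using left_or_right_annihilator assms by metis

lemma p_torsion_killed:
  assumes "z \<in> carrier R" "[p] \<cdot> z = \<zero>"
  shows "[(if p = 2 then 4 else p)] \<cdot> z = \<zero>"
  using add.nat_pow_pow[of z 2 2] assms by auto

definition torsion :: "nat \<Rightarrow> 'a set" where
  "torsion k = {x \<in> carrier R. [(p ^ k)] \<cdot> x = \<zero>}"

lemma torsion_carrier: "x \<in> torsion k \<Longrightarrow> x \<in> carrier R"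
  by (simp add: torsion_def)

lemma torsion_SucD: "x \<in> torsion (Suc k) \<Longrightarrow> [p] \<cdot> ([(p ^ k)] \<cdot> x) = \<zero>"
  by (simp add: torsion_def add.nat_pow_pow mult.commute)

lemma torsion_mono:
  assumes "k \<le> l"
  shows "torsion k \<subseteq> torsion l"
proof
  fix x assume x: "x \<in> torsion k"
  then have "[(p ^ k * p ^ (l - k))] \<cdot> x = \<zero>"
    using add.nat_pow_pow[of x "p ^ (l - k)" "p ^ k"] by (simp add: torsion_def)
  then have "[(p ^ l)] \<cdot> x = \<zero>"
    using assms by (simp flip: power_add)
  then show "x \<in> torsion l" using x by (simp add: torsion_def)
qed

text \<open>
  One of the factors can absorb \<open>p\<^sup>k\<close> and then annihilates the other one. Having both factors in
  the same torsion subgroup is what makes the one-sided hypothesis sufficient.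
\<close>

lemma torsion_mult:
  assumes "x \<in> torsion (Suc k)" "y \<in> torsion (Suc k)"
  shows "[(p ^ k)] \<cdot> (x \<otimes> y) = \<zero>"
proof -
  have c: "x \<in> carrier R" "y \<in> carrier R" using assms torsion_carrier by auto
  have "[(if p = 2 then 4 else p)] \<cdot> ([(p ^ k)] \<cdot> z) = \<zero>" if "z \<in> torsion (Suc k)" for z
    using p_torsion_killed[of "[(p ^ k)] \<cdot> z"] torsion_SucD[OF that] torsion_carrier[OF that] by simp
  then have "([(p ^ k)] \<cdot> x) \<otimes> y = \<zero> \<or> x \<otimes> ([(p ^ k)] \<cdot> y) = \<zero>"
    using left_or_right_annihilator assms c add.nat_pow_closed by meson
  then show ?thesis using c add_pow_mult by metis
qed

text \<open>
  For odd \<open>p\<close>, the element \<open>p\<^sup>k\<^sup>+\<^sup>1 x\<^sup>2\<close> vanishes, so \<open>p\<^sup>k x\<^sup>2\<close> is killed by \<open>p\<close> and annihilates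
  \<open>x\<close>, with which it commutes.
\<close>

lemma cube_torsion:
  assumes "p \<noteq> 2" "x \<in> torsion (Suc (Suc k))"
  shows "[(p ^ k)] \<cdot> (x \<otimes> x \<otimes> x) = \<zero>"
proof -
  have x: "x \<in> carrier R" and xx: "x \<otimes> x \<in> carrier R"
    using assms torsion_carrier m_closed by auto
  let ?z = "[(p ^ k)] \<cdot> (x \<otimes> x)"
  have "[p] \<cdot> ?z = \<zero>" using torsion_mult[OF assms(2,2)] xx by (simp add: add.nat_pow_pow mult.commute)
  moreover have "?z \<otimes> x = x \<otimes> ?z"
    using x xx by (simp flip: add_pow_mult add: m_assoc)
  ultimately have "?z \<otimes> x = \<zero>" using annihilates_commuting[of ?z x] xx x assms(1) by simp
  then show ?thesis using x xx by (simp add: add_pow_mult(1))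
qed

text \<open>
  This is where the number \<open>4\<close> in the definition of nilness enters: \<open>2\<^sup>k x\<close> is only killed by \<open>4\<close>,
  not by \<open>2\<close>. For \<open>p = 2\<close> the binomial coefficient \<open>p choose 2\<close> is \<open>1\<close>, so the square of \<open>x\<close> has
  to vanish without help from that coefficient.
\<close>

lemma square_torsion_2:
  assumes "p = 2" "x \<in> torsion (Suc (Suc k))"
  shows "[(p ^ k)] \<cdot> (x \<otimes> x) = \<zero>"
proof -
  have x: "x \<in> carrier R" using assms torsion_carrier by auto
  let ?z = "[(p ^ k)] \<cdot> x"
  have "[(4::nat)] \<cdot> ?z = \<zero>"
    using assms(2) x unfolding torsion_def by (simp add: assms(1) add.nat_pow_pow mult.commute)
  moreover have "?z \<otimes> x = x \<otimes> ?z"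
    using x by (simp flip: add_pow_mult)
  ultimately have "?z \<otimes> x = \<zero>" using annihilates_commuting[of ?z x] x assms(1) by simp
  then show ?thesis using x by (simp add: add_pow_mult(1))
qed

text \<open>
  Modulo \<open>p\<^sup>k\<close>-torsion, the \<open>p\<close>-th circle power is multiplication by \<open>p\<close>: for odd \<open>p\<close> the quadratic
  term disappears because \<open>p\<close> divides \<open>p choose 2\<close>.
\<close>

lemma circle_pow_p:
  assumes "x \<in> torsion (Suc (Suc k))"
  shows "[(p ^ k)] \<cdot> (x [^]\<^bsub>adjoint_group R\<^esub> p) = [(p ^ Suc k)] \<cdot> x"
proof -
  have x: "x \<in> carrier R" and xx: "x \<otimes> x \<in> carrier R"
    using assms torsion_carrier m_closed by auto
  have "[(p ^ k)] \<cdot> (x \<otimes> x \<otimes> x) = \<zero> \<and> [(p ^ k * (p choose 2))] \<cdot> (x \<otimes> x) = \<zero>"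
  proof (cases "p = 2")
    case True
    then show ?thesis using square_torsion_2[OF True assms] x xx
      by (simp add: add_pow_mult(1)[OF xx x])
  next
    case False
    then have "odd p" using prime_p primes_dvd_imp_eq two_is_prime_nat by blast
    then have "p ^ k * (p choose 2) = p ^ Suc k * ((p - 1) div 2)"
      by (auto simp: choose_two elim!: oddE)
    then have "[(p ^ k * (p choose 2))] \<cdot> (x \<otimes> x) = [((p - 1) div 2)] \<cdot> ([(p ^ Suc k)] \<cdot> (x \<otimes> x))"
      using xx by (simp only: add.nat_pow_pow)
    then show ?thesis using cube_torsion[OF False assms] torsion_mult[OF assms assms] by simp
  qed
  then show ?thesis using circle_pow_quadratic[OF x, of "p ^ k" p] x by (simp add: mult.commute)
qed

lemma circle_pow_p_torsion:
  assumes "x \<in> torsion (Suc k)"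
  shows "x [^]\<^bsub>adjoint_group R\<^esub> p \<in> torsion k"
proof -
  have xc: "x [^]\<^bsub>adjoint_group R\<^esub> p \<in> carrier R" using circle_pow_in_carrier assms torsion_carrier by blast
  show ?thesis
  proof (cases k)
    case 0
    then have "x \<in> torsion (Suc (Suc 0))" using assms torsion_mono[of 1 2] by (auto simp: numeral_2_eq_2)
    from circle_pow_p[OF this] show ?thesis using xc assms 0 by (simp add: torsion_def)
  next
    case (Suc l)
    have "[(p ^ k)] \<cdot> (x [^]\<^bsub>adjoint_group R\<^esub> p) = [p] \<cdot> ([(p ^ l)] \<cdot> (x [^]\<^bsub>adjoint_group R\<^esub> p))"
      using xc Suc by (simp add: add.nat_pow_pow mult.commute)
    also have "\<dots> = [p] \<cdot> ([(p ^ k)] \<cdot> x)" using circle_pow_p[of x l] assms Suc by simp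
    also have "\<dots> = \<zero>" using torsion_SucD[OF assms] .
    finally show ?thesis using xc by (simp add: torsion_def)
  qed
qed

text \<open>
  Repeated \<open>p\<close>-th circle powers descend the torsion filtration to \<open>0\<close>, the identity of the adjoint
  monoid, so all elements are invertible.
\<close>

lemma carrier_adjoint_group: "carrier (adjoint_group R) = carrier R"
proof -
  interpret M: monoid "adjoint_monoid R" by (rule monoid_adjoint_monoid)
  have cM: "carrier (adjoint_monoid R) = carrier R" by (simp add: adjoint_monoid_def)
  have pow: "x [^]\<^bsub>adjoint_monoid R\<^esub> n = x [^]\<^bsub>adjoint_group R\<^esub> n" for x and n :: nat
    by (simp add: nat_pow_def adjoint_group_def units_of_def)
  have "x \<in> Units (adjoint_monoid R)" if "x \<in> torsion k" for x k
    using that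
  proof (induction k arbitrary: x)
    case 0
    then have "x = \<one>\<^bsub>adjoint_monoid R\<^esub>" by (auto simp: torsion_def adjoint_monoid_def)
    then show ?case by simp
  next
    case (Suc k)
    then show ?case
      using M.Units_of_pow[of x p] circle_pow_p_torsion p_pos torsion_carrier by (simp add: cM pow)
  qed
  then have "carrier R \<subseteq> Units (adjoint_monoid R)"
    using p_power_torsion unfolding torsion_def by blast
  then show ?thesis by (auto simp: adjoint_group_def units_of_carrier cM)
qed

text \<open>
  For the inclusion from right to left, descend the filtration: if \<open>x\<close> lies in \<open>T\<^sub>k\<^sub>+\<^sub>2\<close> and its
  \<open>p\<close>-th circle power is \<open>0\<close>, then \<open>p\<^sup>k\<^sup>+\<^sup>1 x = p\<^sup>k 0 = 0\<close>, so \<open>x\<close> lies in \<open>T\<^sub>k\<^sub>+\<^sub>1\<close>.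
\<close>

lemma p_torsion_iff_circle_pow:
  "torsion 1 = {x \<in> carrier R. x [^]\<^bsub>adjoint_group R\<^esub> p = \<zero>}"
proof (intro equalityI subsetI)
  fix x assume "x \<in> torsion 1"
  then show "x \<in> {x \<in> carrier R. x [^]\<^bsub>adjoint_group R\<^esub> p = \<zero>}"
    using circle_pow_p_torsion[of x 0] by (auto simp: torsion_def)
next
  fix x assume x: "x \<in> {x \<in> carrier R. x [^]\<^bsub>adjoint_group R\<^esub> p = \<zero>}"
  have "x \<in> torsion 1" if "x \<in> torsion (Suc k)" for k
    using that
  proof (induction k)
    case (Suc k)
    then have "x \<in> torsion (Suc k)" using circle_pow_p[OF Suc.prems] x by (simp add: torsion_def)
    then show ?case using Suc.IH by simp
  qed simp
  moreover obtain n where "x \<in> torsion n" using x p_power_torsion by (auto simp: torsion_def)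
  moreover have "x \<in> torsion (Suc n)" using torsion_mono[of n "Suc n"] calculation by auto
  ultimately show "x \<in> torsion 1" by blast
qed

section \<open>Generators of subgroups of the adjoint group\<close>

lemma torsion_subgroup: "subgroup (torsion k) (adjoint_group R)"
proof -
  interpret G: group "adjoint_group R" by (rule group_adjoint_group)
  show ?thesis
  proof (rule G.subgroupI)
    show "torsion k \<subseteq> carrier (adjoint_group R)"
      by (auto simp: torsion_def carrier_adjoint_group)
    show "torsion k \<noteq> {}" by (auto simp: torsion_def intro: exI[of _ \<zero>])
  next
    fix x y assume "x \<in> torsion k" "y \<in> torsion k"
    then show "x \<star> y \<in> torsion k"
      by (simp add: torsion_def circle_eq m_closed add.nat_pow_distrib add_pow_mult(1))
  next
    fix x assume x: "x \<in> torsion k"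
    let ?y = "inv\<^bsub>adjoint_group R\<^esub> x"
    have xc: "x \<in> carrier R" using x torsion_carrier by simp
    have yc: "?y \<in> carrier R" using G.inv_closed[of x] xc by (simp add: carrier_adjoint_group)
    have "x \<oplus> ?y \<oplus> x \<otimes> ?y = \<zero>"
      using G.r_inv[of x] xc by (simp add: carrier_adjoint_group circle_eq one_adjoint_group)
    then have "[(p ^ k)] \<cdot> (x \<oplus> ?y \<oplus> x \<otimes> ?y) = \<zero>" by simp
    then show "?y \<in> torsion k"
      using x xc yc by (simp add: torsion_def m_closed add.nat_pow_distrib add_pow_mult(1))
  qed
qed

lemma scaling_hom:
  assumes "x \<in> torsion (Suc k)" "y \<in> torsion (Suc k)"
  shows "[(p ^ k)] \<cdot> (x \<star> y) = [(p ^ k)] \<cdot> x \<oplus> [(p ^ k)] \<cdot> y"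
  using assms[THEN torsion_carrier] torsion_mult[OF assms]
  by (simp add: circle_eq m_closed add.nat_pow_distrib)

text \<open>
  Up to isomorphism this is the quotient of \<open>H \<inter> T\<^sub>k\<^sub>+\<^sub>1\<close> by \<open>H \<inter> T\<^sub>k\<close>. Realizing it inside \<open>T\<^sub>1\<close>
  makes the layers of \<open>H\<close> for different \<open>k\<close> comparable by inclusion.
\<close>

definition layer :: "'a set \<Rightarrow> nat \<Rightarrow> 'a set" where
  "layer H k = (\<lambda>x. [(p ^ k)] \<cdot> x) ` (H \<inter> torsion (Suc k))"

lemma finite_layer: "finite (layer H k)"
  unfolding layer_def by (rule finite_imageI, rule finite_subset[OF _ fin]) (auto simp: torsion_def)

lemma layer_0: "layer H 0 = H \<inter> torsion 1"
  unfolding layer_def by (auto simp: torsion_def)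

lemma layer_subgroup:
  assumes "subgroup H (adjoint_group R)"
  shows "subgroup (layer H k) (add_monoid R)"
proof -
  interpret G: group "adjoint_group R" by (rule group_adjoint_group)
  let ?K = "adjoint_group R\<lparr>carrier := H \<inter> torsion (Suc k)\<rparr>"
  have K: "group ?K"
    using G.subgroup_imp_group[OF G.subgroups_Inter_pair[OF assms torsion_subgroup]] .
  have "(\<lambda>x. [(p ^ k)] \<cdot> x) \<in> hom ?K (add_monoid R)"
    using scaling_hom torsion_carrier by (auto simp: hom_def)
  then have "group_hom ?K (add_monoid R) (\<lambda>x. [(p ^ k)] \<cdot> x)"
    using K by (simp add: group_hom_def group_hom_axioms_def a_group)
  from group_hom.img_is_subgroup[OF this] show ?thesis by (simp add: layer_def)
qed

text \<open>
  The \<open>p\<close>-th circle power of \<open>x\<close> is an element of \<open>H\<close> that witnesses this.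
\<close>

lemma p_multiple_layer:
  assumes "subgroup H (adjoint_group R)" "x \<in> H" "x \<in> torsion (Suc (Suc k))"
  shows "[(p ^ Suc k)] \<cdot> x \<in> layer H k"
  unfolding layer_def
proof (rule image_eqI)
  show "[(p ^ Suc k)] \<cdot> x = [(p ^ k)] \<cdot> (x [^]\<^bsub>adjoint_group R\<^esub> p)"
    using circle_pow_p[OF assms(3)] by simp
  show "x [^]\<^bsub>adjoint_group R\<^esub> p \<in> H \<inter> torsion (Suc k)"
    using circle_pow_p_torsion[OF assms(3)] 
      group.subgroup_nat_pow_closed[OF group_adjoint_group assms(1,2)] by simp
qed

lemma layer_Suc_subset:
  assumes "subgroup H (adjoint_group R)"
  shows "layer H (Suc k) \<subseteq> layer H k"
  using p_multiple_layer[OF assms] by (auto simp: layer_def)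

lemma layer_p_multiple:
  assumes "y \<in> layer H k"
  shows "[p] \<cdot> y = \<zero>"
  using assms torsion_SucD by (auto simp: layer_def)

lemma exponent_exists: "\<exists>e. torsion e = carrier R"
proof -
  obtain f where f: "\<forall>x\<in>carrier R. x \<in> torsion (f x)"
    using p_power_torsion unfolding torsion_def by (metis (mono_tags, lifting) CollectI)
  have "carrier R \<subseteq> torsion (Max (f ` carrier R))"
  proof
    fix x assume "x \<in> carrier R"
    then show "x \<in> torsion (Max (f ` carrier R))"
      using f fin torsion_mono[of "f x" "Max (f ` carrier R)"] by auto
  qed
  then show ?thesis using torsion_carrier by blast
qed

text \<open>
  The assumptions say that \<open>A\<close> generates \<open>H\<close> modulo \<open>T\<^sub>k\<^sub>+\<^sub>1\<close>, and the conclusion is the same with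
  \<open>k\<close> in place of \<open>k + 1\<close>. The new generators are lifts of elements that generate layer \<open>k\<close> over
  layer \<open>k + 1\<close>. Layer \<open>k + 1\<close> itself needs no new generators: modulo \<open>T\<^sub>k\<^sub>+\<^sub>1\<close> each \<open>x\<close> in
  \<open>H \<inter> T\<^sub>k\<^sub>+\<^sub>2\<close> agrees with some \<open>a\<close> generated by \<open>A\<close>, and \<open>p\<^sup>k\<^sup>+\<^sup>1 x = p\<^sup>k\<^sup>+\<^sup>1 a\<close> is the image under
  \<open>p\<^sup>k\<close> of the \<open>p\<close>-th circle power of \<open>a\<close>.
\<close>

lemma partial_generators_step:
  assumes H: "subgroup H (adjoint_group R)" and A: "A \<subseteq> H"
    and dec: "\<And>h. h \<in> H \<Longrightarrow> \<exists>a\<in>generate (adjoint_group R) A. \<exists>w\<in>H \<inter> torsion (Suc k). h = a \<star> w"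
    and card: "p ^ card A \<le> card (layer H (Suc k))"
  shows "\<exists>C\<subseteq>H. (\<forall>h\<in>H. \<exists>a\<in>generate (adjoint_group R) C. \<exists>w\<in>H \<inter> torsion k. h = a \<star> w) \<and>
    p ^ card C \<le> card (layer H k)"
proof -
  interpret G: group "adjoint_group R" by (rule group_adjoint_group)
  have Hc: "H \<subseteq> carrier R" using subgroup.subset[OF H] by (simp add: carrier_adjoint_group)
  have "[p] \<cdot> y \<in> layer H (Suc k)" if "y \<in> layer H k" for y
    using layer_p_multiple[OF that] subgroup.one_closed[OF layer_subgroup[OF H]] by simp
  then obtain B' where B': "B' \<subseteq> layer H k" 
      "generate (add_monoid R) (layer H (Suc k) \<union> B') = layer H k"
      "card (layer H (Suc k)) * p ^ card B' \<le> card (layer H k)"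
    using add.exists_generators_over[OF prime_p layer_subgroup[OF H] finite_layer
        layer_subgroup[OF H] layer_Suc_subset[OF H]] by meson
  obtain B where B: "B \<subseteq> H \<inter> torsion (Suc k)" "inj_on (\<lambda>x. [(p ^ k)] \<cdot> x) B" 
      "B' = (\<lambda>x. [(p ^ k)] \<cdot> x) ` B"
    using B'(1) unfolding layer_def subset_image_inj by blast
  let ?K = "generate (adjoint_group R) (A \<union> B)"
  have AB: "A \<union> B \<subseteq> H" using A B(1) by auto
  then have ABc: "A \<union> B \<subseteq> carrier (adjoint_group R)" using Hc by (auto simp: carrier_adjoint_group)
  have K: "subgroup ?K (adjoint_group R)" using G.generate_is_subgroup[OF ABc] .
  have KH: "?K \<subseteq> H" using G.generate_subgroup_incl[OF AB H] .
  have AK: "generate (adjoint_group R) A \<subseteq> ?K" by (rule G.mono_generate) simp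
  have "layer H (Suc k) \<subseteq> layer ?K k"
  proof
    fix y assume "y \<in> layer H (Suc k)"
    then obtain x where x: "x \<in> H" "x \<in> torsion (Suc (Suc k))" "y = [(p ^ Suc k)] \<cdot> x"
      by (auto simp: layer_def)
    obtain a w where aw: "a \<in> generate (adjoint_group R) A" "w \<in> H" "w \<in> torsion (Suc k)" "x = a \<star> w"
      using dec[OF x(1)] by blast
    have aK: "a \<in> ?K" using aw(1) AK by blast
    have ac: "a \<in> carrier R" using aK KH Hc by blast
    have wc: "w \<in> carrier R" and w2: "w \<in> torsion (Suc (Suc k))"
      using aw(3) torsion_carrier torsion_mono[of "Suc k" "Suc (Suc k)"] by auto
    have "a = x \<star> inv\<^bsub>adjoint_group R\<^esub> w"
      using aw(4) ac wc x(1) Hc by (subst G.inv_solve_right) (auto simp: carrier_adjoint_group)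
    then have a2: "a \<in> torsion (Suc (Suc k))"
      using x(2) w2 torsion_subgroup by (simp add: subgroup.m_closed subgroup.m_inv_closed)
    have "y = [(p ^ Suc k)] \<cdot> a \<oplus> [(p ^ Suc k)] \<cdot> w"
      using scaling_hom[OF a2 w2] x(3) aw(4) by simp
    then have "y = [(p ^ Suc k)] \<cdot> a" using aw(3) ac by (simp add: torsion_def)
    then show "y \<in> layer ?K k" using p_multiple_layer[OF K aK a2] by simp
  qed
  moreover have "B' \<subseteq> layer ?K k"
    using B by (auto simp: layer_def intro!: imageI generate.incl)
  ultimately have gen: "layer H k \<subseteq> layer ?K k"
    using add.generate_subgroup_incl[OF _ layer_subgroup[OF K]] B'(2) by (metis Un_least)
  \<comment> \<open>As layer \<open>k\<close> of \<open>H\<close> is contained in that of \<open>?K\<close>, an element of \<open>?K\<close> moves \<open>w\<close> from \<open>T\<^sub>k\<^sub>+\<^sub>1\<close> into \<open>T\<^sub>k\<close>.\<close>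
  have "\<exists>a\<in>?K. \<exists>w\<in>H \<inter> torsion k. h = a \<star> w" if h: "h \<in> H" for h
  proof -
    obtain a w where aw: "a \<in> ?K" "w \<in> H" "w \<in> torsion (Suc k)" "h = a \<star> w"
      using dec[OF h] AK by blast
    then have "[(p ^ k)] \<cdot> w \<in> layer ?K k" using gen by (auto simp: layer_def)
    then obtain c where c: "c \<in> ?K" "c \<in> torsion (Suc k)" "[(p ^ k)] \<cdot> w = [(p ^ k)] \<cdot> c"
      by (auto simp: layer_def)
    have cc: "a \<in> carrier R" "w \<in> carrier R" "c \<in> carrier R" 
      using aw c KH Hc by auto
    define v where "v = inv\<^bsub>adjoint_group R\<^esub> c \<star> w"
    have v: "v \<in> H" "v \<in> torsion (Suc k)"
      using c aw KH H torsion_subgroup by (auto simp: v_def intro!: subgroup.m_closed subgroup.m_inv_closed)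
    have wcv: "w = c \<star> v" 
      using cc[folded carrier_adjoint_group] by (simp add: v_def G.m_assoc[symmetric])
    have "[(p ^ k)] \<cdot> c = [(p ^ k)] \<cdot> c \<oplus> [(p ^ k)] \<cdot> v"
      using scaling_hom[OF c(2) v(2)] c(3) by (simp only: wcv[symmetric])
    then have "[(p ^ k)] \<cdot> v = \<zero>" using cc v(2) torsion_carrier by simp
    then have "v \<in> torsion k" using v(2) by (simp add: torsion_def)
    moreover have "h = (a \<star> c) \<star> v"
      using aw(4) wcv cc torsion_carrier[OF v(2)] by (simp add: G.m_assoc carrier_adjoint_group)
    moreover have "a \<star> c \<in> ?K" using aw c by (simp add: generate.eng)
    ultimately show ?thesis using v by blast
  qed
  moreover have "p ^ card (A \<union> B) \<le> card (layer H k)"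
  proof -
    have "card B' = card B" using B card_image by blast
    then have "p ^ card (A \<union> B) \<le> p ^ card A * p ^ card B'"
      using p_pos card_Un_le[of A B] by (simp add: power_increasing flip: power_add)
    also have "\<dots> \<le> card (layer H (Suc k)) * p ^ card B'" using card by simp
    finally show ?thesis using B'(3) by simp
  qed
  ultimately show ?thesis using AB by blast
qed

text \<open>
  Descending from a \<open>k\<close> with \<open>T\<^sub>k = R\<close>, where the empty set of generators is enough, to \<open>k = 0\<close>,
  where the torsion part is trivial and layer \<open>0\<close> is \<open>H \<inter> T\<^sub>1\<close>.
\<close>

lemma subgroup_generators:
  assumes H: "subgroup H (adjoint_group R)"
  shows "\<exists>A\<subseteq>H. generate (adjoint_group R) A = H \<and> p ^ card A \<le> card (torsion 1)"
proof -
  interpret G: group "adjoint_group R" by (rule group_adjoint_group)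
  have Hc: "H \<subseteq> carrier R" using subgroup.subset[OF H] by (simp add: carrier_adjoint_group)
  obtain e where e: "torsion e = carrier R" using exponent_exists by blast
  let ?P = "\<lambda>k. \<exists>A\<subseteq>H. (\<forall>h\<in>H. \<exists>a\<in>generate (adjoint_group R) A. \<exists>w\<in>H \<inter> torsion k. h = a \<star> w) \<and>
    p ^ card A \<le> card (layer H k)"
  have "?P k" if "k \<le> e" for k
    using that
  proof (induction k rule: inc_induct)
    case base
    have "card (layer H e) \<noteq> 0" using subgroup.one_closed[OF layer_subgroup[OF H]] finite_layer by auto
    moreover have "\<exists>a\<in>generate (adjoint_group R) {}. \<exists>w\<in>H \<inter> torsion e. h = a \<star> w" if "h \<in> H" for h
      using that Hc e G.l_one[of h] generate.one[of "adjoint_group R" "{}"] 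
      by (metis IntI carrier_adjoint_group subsetD)
    ultimately show ?case by (intro exI[of _ "{}"] conjI ballI) (simp_all add: Suc_le_eq)
  next
    case (step k)
    then obtain A where "A \<subseteq> H" "p ^ card A \<le> card (layer H (Suc k))"
      "\<And>h. h \<in> H \<Longrightarrow> \<exists>a\<in>generate (adjoint_group R) A. \<exists>w\<in>H \<inter> torsion (Suc k). h = a \<star> w"
      by blast
    then show ?case using partial_generators_step[OF H, of A k] by blast
  qed
  from this[of 0] obtain A where A: "A \<subseteq> H" "p ^ card A \<le> card (layer H 0)" 
    "\<And>h. h \<in> H \<Longrightarrow> \<exists>a\<in>generate (adjoint_group R) A. \<exists>w\<in>H \<inter> torsion 0. h = a \<star> w" by auto
  have "H \<subseteq> generate (adjoint_group R) A"
  proof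
    fix h assume "h \<in> H"
    then obtain a w where aw: "a \<in> generate (adjoint_group R) A" "w \<in> torsion 0" "h = a \<star> w" 
      using A(3) by blast
    have "w = \<one>\<^bsub>adjoint_group R\<^esub>" using aw(2) by (auto simp: torsion_def one_adjoint_group)
    moreover have "a \<in> carrier (adjoint_group R)"
      using G.generate_in_carrier[OF _ aw(1)] A(1) Hc by (simp add: carrier_adjoint_group)
    ultimately show "h \<in> generate (adjoint_group R) A" using aw by simp
  qed
  then have "generate (adjoint_group R) A = H" using G.generate_subgroup_incl[OF A(1) H] by (rule equalityI[rotated])
  moreover have "card (layer H 0) \<le> card (torsion 1)"
    using fin torsion_carrier by (intro card_mono) (auto simp: layer_0 intro: finite_subset[OF _ fin])
  ultimately show ?thesis using A(1,2) by (intro exI[of _ A]) simp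
qed

section \<open>Generators of the additive group\<close>

lemma p_multiples_subgroup: "subgroup ((\<lambda>x. [p] \<cdot> x) ` carrier R) (add_monoid R)"
proof -
  have "(\<lambda>x. [p] \<cdot> x) \<in> hom (add_monoid R) (add_monoid R)"
    by (auto simp: hom_def add.nat_pow_distrib)
  then have "group_hom (add_monoid R) (add_monoid R) (\<lambda>x. [p] \<cdot> x)"
    by (simp add: group_hom_def group_hom_axioms_def a_group)
  from group_hom.img_is_subgroup[OF this] show ?thesis by simp
qed

text \<open>
  Multiplication by \<open>p\<close> has kernel \<open>T\<^sub>1\<close>; a section \<open>s\<close> of it onto its image splits \<open>R\<close> as a set.
\<close>

lemma card_carrier: "card (carrier R) = card ((\<lambda>x. [p] \<cdot> x) ` carrier R) * card (torsion 1)"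
proof -
  let ?f = "\<lambda>x. [p] \<cdot> x"
  define s where "s = inv_into (carrier R) ?f"
  have s: "s y \<in> carrier R" "[p] \<cdot> s y = y" if "y \<in> ?f ` carrier R" for y
    using that unfolding s_def by (auto intro: inv_into_into f_inv_into_f)
  have "bij_betw (\<lambda>(y, t). s y \<oplus> t) (?f ` carrier R \<times> torsion 1) (carrier R)"
  proof (rule bij_betw_imageI)
    have eq: "[p] \<cdot> (s y \<oplus> t) = y" if "y \<in> ?f ` carrier R" "t \<in> torsion 1" for y t
      using s[OF that(1)] that by (auto simp: add.nat_pow_distrib torsion_def)
    show "inj_on (\<lambda>(y, t). s y \<oplus> t) (?f ` carrier R \<times> torsion 1)"
    proof (rule inj_onI)
      fix v w assume v: "v \<in> ?f ` carrier R \<times> torsion 1" and w: "w \<in> ?f ` carrier R \<times> torsion 1"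
        and vw: "(\<lambda>(y, t). s y \<oplus> t) v = (\<lambda>(y, t). s y \<oplus> t) w"
      obtain y t z u where [simp]: "v = (y, t)" "w = (z, u)" by (cases v, cases w) 
      have y: "y \<in> ?f ` carrier R" "t \<in> torsion 1" and z: "z \<in> ?f ` carrier R" "u \<in> torsion 1"
        and *: "s y \<oplus> t = s z \<oplus> u" using v w vw by simp_all
      have "y = z" using eq[OF y] eq[OF z] * by simp
      then have "t = u" using * s(1)[OF y(1)] y(2) z(2) torsion_carrier by simp
      then show "v = w" using \<open>y = z\<close> by simp
    qed
    show "(\<lambda>(y, t). s y \<oplus> t) ` (?f ` carrier R \<times> torsion 1) = carrier R"
    proof (intro equalityI subsetI)
      fix x assume x: "x \<in> carrier R"
      let ?y = "[p] \<cdot> x"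
      have y: "?y \<in> ?f ` carrier R" using x by auto
      have "x \<ominus> s ?y \<in> torsion 1"
        using x s[OF y] by (simp add: torsion_def a_minus_def add.nat_pow_distrib add.nat_pow_inv r_neg)
      moreover have "x = s ?y \<oplus> (x \<ominus> s ?y)"
        using x s[OF y] by (simp add: a_minus_def a_lcomm r_neg)
      ultimately show "x \<in> (\<lambda>(y, t). s y \<oplus> t) ` (?f ` carrier R \<times> torsion 1)" using y by force
    qed (use s(1) torsion_carrier in force)
  qed
  then show ?thesis using bij_betw_same_card card_cartesian_product by metis
qed

text \<open>
  Lifts of a basis of \<open>R\<close> modulo \<open>p R\<close> generate \<open>R\<close>: if \<open>R = S + p R\<close> for a subgroup \<open>S\<close>, then
  \<open>R = S + p\<^sup>n R\<close> for all \<open>n\<close>, and \<open>p\<^sup>n R = 0\<close> for large \<open>n\<close>.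
\<close>

lemma additive_generators:
  "\<exists>A\<subseteq>carrier R. generate (add_monoid R) A = carrier R \<and> p ^ card A \<le> card (torsion 1)"
proof -
  let ?I = "(\<lambda>x. [p] \<cdot> x) ` carrier R"
  obtain A where A: "A \<subseteq> carrier R" "generate (add_monoid R) (?I \<union> A) = carrier R" 
    "card ?I * p ^ card A \<le> card (carrier R)"
    using add.exists_generators_over[OF prime_p add.subgroup_self fin p_multiples_subgroup] by auto
  have "0 < card ?I" using fin card_gt_0_iff by blast
  then have card: "p ^ card A \<le> card (torsion 1)" using A(3) card_carrier by simp
  let ?S = "generate (add_monoid R) A"
  have Sc: "s \<in> carrier R" if "s \<in> ?S" for s using add.generate_in_carrier A(1) that by auto
  \<comment> \<open>Only \<open>R = S + p R\<close> is read off from the choice of \<open>A\<close>; the rest is iteration.\<close>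
  have one: "\<exists>s\<in>?S. \<exists>y\<in>carrier R. x = s \<oplus> [p] \<cdot> y" if "x \<in> generate (add_monoid R) (?I \<union> A)" for x
    using that
  proof (induction rule: generate.induct)
    case one
    have "\<zero> \<in> ?S" using generate.one[of "add_monoid R" A] by simp
    then show ?case by (intro bexI[of _ \<zero>]) auto
  next
    case (incl h)
    then show ?case
    proof
      assume "h \<in> ?I"
      then obtain y where "y \<in> carrier R" "h = [p] \<cdot> y" by auto
      moreover have "\<zero> \<in> ?S" using generate.one[of "add_monoid R" A] by simp
      ultimately show ?thesis by (intro bexI[of _ \<zero>] bexI[of _ y]) auto
    next
      assume "h \<in> A"
      then show ?thesis using A(1) by (intro bexI[of _ h] bexI[of _ \<zero>]) (auto intro: generate.incl)
    qed
  next
    case (inv h)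
    then show ?case
    proof
      assume "h \<in> ?I"
      then obtain y where "y \<in> carrier R" "h = [p] \<cdot> y" by auto
      moreover have "\<zero> \<in> ?S" using generate.one[of "add_monoid R" A] by simp
      ultimately show ?thesis
        by (intro bexI[of _ \<zero>] bexI[of _ "\<ominus> y"]) (auto simp: add.nat_pow_inv a_inv_def[symmetric])
    next
      assume "h \<in> A"
      then show ?thesis using A(1) generate.inv[of h A "add_monoid R"]
        by (intro bexI[of _ "\<ominus> h"] bexI[of _ \<zero>]) (auto simp: a_inv_def[symmetric])
    qed
  next
    case (eng h1 h2)
    then obtain s t y z where "s \<in> ?S" "t \<in> ?S" "y \<in> carrier R" "z \<in> carrier R" 
      "h1 = s \<oplus> [p] \<cdot> y" "h2 = t \<oplus> [p] \<cdot> z" by blast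
    moreover from this have "s \<oplus> t \<in> ?S" using generate.eng[of s "add_monoid R" A t] by simp
    ultimately show ?case using Sc
      by (intro bexI[of _ "s \<oplus> t"] bexI[of _ "y \<oplus> z"]) (auto simp: add.nat_pow_distrib a_ac)
  qed
  have power: "\<exists>s\<in>?S. \<exists>y\<in>carrier R. x = s \<oplus> [(p ^ n)] \<cdot> y" if "x \<in> carrier R" for x n
  proof (induction n)
    case 0
    have "\<zero> \<in> ?S" using generate.one[of "add_monoid R" A] by simp
    then show ?case using that by (intro bexI[of _ \<zero>] bexI[of _ x]) auto
  next
    case (Suc n)
    then obtain s y where s: "s \<in> ?S" "y \<in> carrier R" "x = s \<oplus> [(p ^ n)] \<cdot> y" by blast
    obtain t z where t: "t \<in> ?S" "z \<in> carrier R" "y = t \<oplus> [p] \<cdot> z" using one s(2) A(2) by blast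
    have S: "subgroup ?S (add_monoid R)" using add.generate_is_subgroup A(1) by simp
    have "[(p ^ n)] \<cdot> t \<in> ?S" using add.subgroup_nat_pow_closed[OF S t(1)] .
    then have "s \<oplus> [(p ^ n)] \<cdot> t \<in> ?S" using s(1) generate.eng[of s "add_monoid R" A] by simp
    moreover have "x = (s \<oplus> [(p ^ n)] \<cdot> t) \<oplus> [(p ^ Suc n)] \<cdot> z"
      using s t Sc by (simp add: add.nat_pow_distrib add.nat_pow_pow a_assoc)
    ultimately show ?case using t(2) by blast
  qed
  obtain e where e: "torsion e = carrier R" using exponent_exists by blast
  have "x \<in> ?S" if x: "x \<in> carrier R" for x
  proof -
    obtain s y where "s \<in> ?S" "y \<in> carrier R" "x = s \<oplus> [(p ^ e)] \<cdot> y" 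
      using power[OF x] by blast
    moreover from this have "[(p ^ e)] \<cdot> y = \<zero>" using e by (auto simp: torsion_def)
    ultimately show ?thesis using Sc by simp
  qed
  then have "?S = carrier R" using Sc by blast
  then show ?thesis using A(1) card by blast
qed

text \<open>
  Generators of \<open>R\<close> generate it over \<open>p R\<close>, whose index is the order of \<open>T\<^sub>1\<close>.
\<close>

lemma additive_generators_lower_bound:
  assumes "finite A" "A \<subseteq> carrier R" "generate (add_monoid R) A = carrier R"
  shows "card (torsion 1) \<le> p ^ card A"
proof -
  let ?I = "(\<lambda>x. [p] \<cdot> x) ` carrier R"
  have "generate (add_monoid R) A \<subseteq> generate (add_monoid R) (?I \<union> A)"
    by (rule add.mono_generate) simp
  then have "carrier R \<subseteq> generate (add_monoid R) (?I \<union> A)" using assms(3) by simp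
  moreover have "finite (generate (add_monoid R) (?I \<union> A)) \<and> 
      card (generate (add_monoid R) (?I \<union> A)) \<le> card ?I * p ^ card A"
    using add.card_generate_le[OF assms(1,2) p_multiples_subgroup] assms(2) fin p_pos by auto
  ultimately have "card (carrier R) \<le> card ?I * p ^ card A" using card_mono order_trans by blast
  moreover have "0 < card ?I" using fin card_gt_0_iff by blast
  ultimately show ?thesis using card_carrier by simp
qed

section \<open>The subgroup generated by the elements of order p\<close>

lemma torsion_1_comm_group: "comm_group (adjoint_group R\<lparr>carrier := torsion 1\<rparr>)"
proof -
  interpret T: group "adjoint_group R\<lparr>carrier := torsion 1\<rparr>"
    using group.subgroup_imp_group[OF group_adjoint_group torsion_subgroup] .
  have "x \<star> y = y \<star> x" if "x \<in> torsion (Suc 0)" "y \<in> torsion (Suc 0)" for x y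
    using torsion_mult[OF that] torsion_mult[OF that(2,1)] that[THEN torsion_carrier]
    by (simp add: circle_eq m_closed a_comm)
  then show ?thesis by (intro T.group_comm_groupI) simp
qed

lemma torsion_1_generators_lower_bound:
  assumes "finite A" "A \<subseteq> torsion 1" "generate (adjoint_group R) A = torsion 1"
  shows "card (torsion 1) \<le> p ^ card A"
proof -
  interpret G: group "adjoint_group R" by (rule group_adjoint_group)
  interpret T: comm_group "adjoint_group R\<lparr>carrier := torsion 1\<rparr>" by (rule torsion_1_comm_group)
  have "x [^]\<^bsub>adjoint_group R\<lparr>carrier := torsion 1\<rparr>\<^esub> p = \<zero>" if "x \<in> A" for x
    using p_torsion_iff_circle_pow that assms(2) by (auto simp: nat_pow_def one_adjoint_group)
  then have "card (generate (adjoint_group R\<lparr>carrier := torsion 1\<rparr>) ({\<zero>} \<union> A)) \<le> card {\<zero>} * p ^ card A"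
    using T.card_generate_le[OF assms(1), of "{\<zero>}" p] assms(2) T.triv_subgroup p_pos
    by (simp add: one_adjoint_group)
  moreover have "generate (adjoint_group R\<lparr>carrier := torsion 1\<rparr>) ({\<zero>} \<union> A) = torsion 1"
  proof -
    have z: "{\<zero>} \<union> A \<subseteq> torsion 1" using assms(2) by (auto simp: torsion_def)
    have "generate (adjoint_group R) ({\<zero>} \<union> A) = torsion 1"
      using G.generate_subgroup_incl[OF z torsion_subgroup] G.mono_generate[of A "{\<zero>} \<union> A"] assms(3) by auto
    then show ?thesis using G.generate_consistent[OF z torsion_subgroup] by simp
  qed
  ultimately show ?thesis by simp
qed

lemma Omega1_adjoint_group: "Omega1 p (adjoint_group R) = adjoint_group R\<lparr>carrier := torsion 1\<rparr>"
proof -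
  have "{x \<in> carrier (adjoint_group R). x [^]\<^bsub>adjoint_group R\<^esub> p = \<one>\<^bsub>adjoint_group R\<^esub>} = torsion 1"
    by (simp only: p_torsion_iff_circle_pow carrier_adjoint_group one_adjoint_group)
  moreover have "generate (adjoint_group R) (torsion 1) = torsion 1"
    using group.generateI[OF group_adjoint_group torsion_subgroup] by (metis subset_refl)
  ultimately show ?thesis by (simp add: Omega1_def)
qed

end

section \<open>The rank of the adjoint group\<close>

lemma min_gens_eqI:
  assumes "(p::nat) > 1" "finite A" "A \<subseteq> carrier G" "generate G A = carrier G" "p ^ card A \<le> p ^ d"
    and "\<And>B. finite B \<Longrightarrow> B \<subseteq> carrier G \<Longrightarrow> generate G B = carrier G \<Longrightarrow> p ^ d \<le> p ^ card B"
  shows "min_gens G = enat d"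
proof (rule antisym)
  have "min_gens G \<le> enat (card A)" unfolding min_gens_def by (rule INF_lower) (use assms in auto)
  then show "min_gens G \<le> enat d" using assms(1,5) by (simp add: order_trans)
  show "enat d \<le> min_gens G" unfolding min_gens_def
    using assms(1,6) by (intro INF_greatest) auto
qed

theorem theoremB:
  fixes p :: nat and R :: "('a, 'm) ring_scheme"
  assumes "Factorial_Ring.prime p"
    and "p_ring p R"
    and "finite (carrier R)"
    and "left_p_nil p R \<or> right_p_nil p R"
  shows "pruefer_rank (adjoint_group R) = min_gens (add_monoid R)
       \<and> pruefer_rank (adjoint_group R) = min_gens (Omega1 p (adjoint_group R))"
proof -
  interpret R: nonunital_ring R using assms(2) by (simp add: p_ring_def)
  have "\<exists>n::nat. [(p ^ n)] \<cdot>\<^bsub>R\<^esub> x = \<zero>\<^bsub>R\<^esub>" if x: "x \<in> carrier R" for x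
  proof -
    obtain n where "group.ord (add_monoid R) x = p ^ n"
      using assms(2) x by (auto simp: p_ring_def is_p_group_def)
    then show ?thesis using R.add.pow_ord_eq_1[of x] x by metis
  qed
  then interpret p_nil_ring R p
    using assms by unfold_locales auto
  interpret G: group "adjoint_group R" by (rule R.group_adjoint_group)
  let ?T = "adjoint_group R\<lparr>carrier := torsion 1\<rparr>"
  have p1: "p > 1" using prime_p prime_gt_1_nat by blast
  obtain C where C: "C \<subseteq> carrier R" "generate (add_monoid R) C = carrier R" "p ^ card C \<le> card (torsion 1)"
    using additive_generators by blast
  have finC: "finite C" using C(1) fin finite_subset by blast
  define d where "d = card C"
  have d: "card (torsion 1) = p ^ d"
    using C additive_generators_lower_bound[OF finC] by (simp add: d_def)
  have "min_gens (add_monoid R) = enat d"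
    using p1 finC C d additive_generators_lower_bound by (intro min_gens_eqI[of p C]) auto
  moreover have rank_le: "min_gens (adjoint_group R\<lparr>carrier := H\<rparr>) \<le> enat d" 
    if H: "subgroup H (adjoint_group R)" for H
  proof -
    obtain A where A: "A \<subseteq> H" "generate (adjoint_group R) A = H" "p ^ card A \<le> card (torsion 1)"
      using subgroup_generators[OF H] by blast
    have "finite A" using A(1) subgroup.subset[OF H] fin finite_subset by (metis carrier_adjoint_group)
    then have "min_gens (adjoint_group R\<lparr>carrier := H\<rparr>) \<le> enat (card A)"
      unfolding min_gens_def using A G.generate_consistent[OF A(1) H] by (intro INF_lower) auto
    then show ?thesis using A(3) d p1 by (simp add: order_trans)
  qed
  obtain D where D: "D \<subseteq> torsion 1" "generate (adjoint_group R) D = torsion 1" "p ^ card D \<le> card (torsion 1)"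
    using subgroup_generators[OF torsion_subgroup] by blast
  have finD: "finite D" using D(1) torsion_carrier fin by (meson finite_subset subset_iff)
  have gT: "generate ?T B = generate (adjoint_group R) B" if "B \<subseteq> torsion 1" for B
    using G.generate_consistent[OF that torsion_subgroup] .
  have T: "min_gens ?T = enat d"
  proof (rule min_gens_eqI[OF p1 finD])
    show "p ^ d \<le> p ^ card B" if "finite B" "B \<subseteq> carrier ?T" "generate ?T B = carrier ?T" for B
    proof -
      have B: "B \<subseteq> torsion 1" using that(2) by simp
      have "generate (adjoint_group R) B = torsion 1" using that(3) unfolding gT[OF B] by simp
      from torsion_1_generators_lower_bound[OF that(1) B this] show ?thesis unfolding d .
    qed
    show "generate ?T D = carrier ?T" unfolding gT[OF D(1)] D(2) by simp
    show "p ^ card D \<le> p ^ d" using D(3) d by simp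
  qed (use D(1) in simp)
  have "pruefer_rank (adjoint_group R) = enat d"
  proof (rule antisym)
    show "pruefer_rank (adjoint_group R) \<le> enat d"
      unfolding pruefer_rank_def using rank_le by (intro SUP_least) auto
    have "fin_gen ?T" unfolding fin_gen_def using finD D(1) gT[OF D(1)] D(2) by (intro exI[of _ D]) simp
    then have "min_gens ?T \<le> pruefer_rank (adjoint_group R)"
      unfolding pruefer_rank_def using torsion_subgroup by (intro SUP_upper) auto
    then show "enat d \<le> pruefer_rank (adjoint_group R)" using T by simp
  qed
  ultimately show ?thesis using T Omega1_adjoint_group by simp
qed

end
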